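(* For every $\beta\in\mathbb{R}^{mK}$, the Hessian matrix $H=\nabla^2\mathcal{L}(\beta)$ is symmetric and positive semidefinite. Moreover, its kernel is exactly the $K$-dimensional subspace of block-wise constant vectors, namely $$\ker(H)=\{d=(d_1^\top,\dots,d_K^\top)^\top\in\mathbb{R}^{mK} : d_k=c_k\mathbf{1}_m,\ c_k\in\mathbb{R},\ \forall k\in[K]\}.$$ Furthermore, the gradient $g=\nabla\mathcal{L}(\beta)$ is orthogonal to this kernel, i.e. $g\in\ker(H)^\perp$. Consequently, the Newton system $H\,d=-g$ is consistent (has a solution $d\in\mathbb{R}^{mK}$).
   Context: Let $n,m,K\ge 1$ be integers, $[K]=\{1,\dots,K\}$, $[n]=\{1,\dots,n\}$, $\eta,\tau>0$, and let $\Delta_d=\{x\in\mathbb{R}_+^d:\sum_{i=1}^d x_i=1\}$ be the probability simplex. Let $\mu_k\in\Delta_m$ and $C_k\in\mathbb{R}_+^{n\times m}$ for $k\in[K]$, $w_k>0$ with $\sum_{k=1}^K w_k=1$, and let $\pi\in\Delta_n$ have full support (all entries strictly positive). $\mathbf{1}_m$ is the all-ones vector in $\mathbb{R}^m$, and $\ker(H)^\perp$ is the orthogonal complement of $\ker(H)$ in $\mathbb{R}^{mK}$. For $\beta=(\beta_1^\top,\dots,\beta_K^\top)^\top\in\mathbb{R}^{mK}$ with $\beta_k\in\mathbb{R}^m$ define: - $[\alpha_k(\beta_k)]_i=-\eta\log\big(\sum_{j=1}^m[\mu_k]_j\exp(([\beta_k]_j-[C_k]_{ij})/\eta)\big)$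 for $i\in[n]$, and $\Phi(\beta)=\sum_{k=1}^K w_k\alpha_k(\beta_k)\in\mathbb{R}^n$; - $\mathcal{L}(\beta)=-\sum_{k=1}^K w_k\langle\beta_k,\mu_k\rangle+\tau\log\big(\sum_{i=1}^n\pi_i\exp(-[\Phi(\beta)]_i/\tau)\big)$; - $v=v(\beta)\in\Delta_n$, $v_i=\pi_i\exp(-[\Phi(\beta)]_i/\tau)\big/\sum_{l=1}^n\pi_l\exp(-[\Phi(\beta)]_l/\tau)$; - $P_k=P_k(\beta_k)\in\mathbb{R}^{n\times m}$, $[P_k]_{ij}=\dfrac{[\mu_k]_j\exp(([\beta_k]_j-[C_k]_{ij})/\eta)}{\sum_{l=1}^m[\mu_k]_l\exp(([\beta_k]_l-[C_k]_{il})/\eta)}$ (row-stochastic), and $\gamma_k=P_k^\top v$. The gradient $g=\nabla\mathcal{L}(\beta)$ has blocks $g_k=w_k(P_k^\top v-\mu_k)$, and the Hessian $H=\nabla^2\mathcal{L}(\beta)$ has $m\times m$ blocks $$H_{kk}=\tfrac{w_k^2}{\tau}\big(P_k^\top\mathrm{diag}(v)P_k-\gamma_k\gamma_k^\top\big)+\tfrac{w_k}{\eta}\big(\mathrm{diag}(\gamma_k)-P_k^\top\mathrm{diag}(v)P_k\big),$$ $$H_{kr}=\tfrac{w_kw_r}{\tau}\big(P_k^\top\mathrm{diag}(v)P_r-\gamma_k\gamma_r^\top\big)\quad(k\ne r).$$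
   Formalization: The kernel equality is stated only when every μ_k has full support (it fails otherwise: n=K=1, m=2, μ=(1,0) gives H=0); for general μ_k in the simplex only the inclusion of the block-wise constant vectors in ker(H) is stated. All other claims hold for every μ_k in the simplex. *)

theory Defs
  imports "HOL-Analysis.Analysis"
begin

definition prob_simplex :: "(real^'d) set" where
  "prob_simplex = {x. (\<forall>i. 0 \<le> x $ i) \<and> (\<Sum>i\<in>UNIV. x $ i) = 1}"

definition diag_matrix :: "real^'d \<Rightarrow> real^'d^'d" where
  "diag_matrix v = (\<chi> i j. if i = j then v $ i else 0)"

definition outer_prod :: "real^'a \<Rightarrow> real^'b \<Rightarrow> real^'b^'a" where
  "outer_prod x y = (\<chi> i j. x $ i * y $ j)"

text \<open>
  The index types \<open>'n\<close>, \<open>'m\<close>, \<open>'k\<close> play the roles of the sets of the first n, m and K positive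
  integers. A stacked vector is indexed by pairs \<open>(k, j)\<close>: block \<open>k\<close>, entry \<open>j\<close>.
\<close>

definition block :: "real^('k::finite \<times> 'm::finite) \<Rightarrow> 'k \<Rightarrow> real^'m" where
  "block \<beta> k = (\<chi> j. \<beta> $ (k, j))"

text \<open>
  In the next two definitions \<open>\<mu>\<close>, \<open>C\<close>, \<open>b\<close> are the data of a single block.
\<close>

definition alpha :: "real \<Rightarrow> real^'m \<Rightarrow> real^'m^'n \<Rightarrow> real^'m \<Rightarrow> real^'n" where
  "alpha \<eta> \<mu> C b =
    (\<chi> i. - \<eta> * ln (\<Sum>j\<in>UNIV. \<mu> $ j * exp ((b $ j - C $ i $ j) / \<eta>)))"

definition plan :: "real \<Rightarrow> real^'m \<Rightarrow> real^'m^'n \<Rightarrow> real^'m \<Rightarrow> real^'m^'n" where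
  "plan \<eta> \<mu> C b =
    (\<chi> i j. \<mu> $ j * exp ((b $ j - C $ i $ j) / \<eta>) /
      (\<Sum>l\<in>UNIV. \<mu> $ l * exp ((b $ l - C $ i $ l) / \<eta>)))"

definition Phi ::
  "real \<Rightarrow> ('k \<Rightarrow> real) \<Rightarrow> ('k \<Rightarrow> real^'m) \<Rightarrow> ('k \<Rightarrow> real^'m^'n)
    \<Rightarrow> real^('k::finite \<times> 'm::finite) \<Rightarrow> real^'n" where
  "Phi \<eta> w \<mu> C \<beta> = (\<Sum>k\<in>UNIV. w k *\<^sub>R alpha \<eta> (\<mu> k) (C k) (block \<beta> k))"

definition dual_loss ::
  "real \<Rightarrow> real \<Rightarrow> ('k \<Rightarrow> real) \<Rightarrow> ('k \<Rightarrow> real^'m) \<Rightarrow> ('k \<Rightarrow> real^'m^'n) \<Rightarrow> real^'n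
    \<Rightarrow> real^('k::finite \<times> 'm::finite) \<Rightarrow> real" where
  "dual_loss \<eta> \<tau> w \<mu> C \<pi> \<beta> =
    - (\<Sum>k\<in>UNIV. w k * (block \<beta> k \<bullet> \<mu> k))
    + \<tau> * ln (\<Sum>i\<in>UNIV. \<pi> $ i * exp (- (Phi \<eta> w \<mu> C \<beta> $ i) / \<tau>))"

definition bary ::
  "real \<Rightarrow> real \<Rightarrow> ('k \<Rightarrow> real) \<Rightarrow> ('k \<Rightarrow> real^'m) \<Rightarrow> ('k \<Rightarrow> real^'m^'n) \<Rightarrow> real^'n
    \<Rightarrow> real^('k::finite \<times> 'm::finite) \<Rightarrow> real^'n" where
  "bary \<eta> \<tau> w \<mu> C \<pi> \<beta> =
    (\<chi> i. \<pi> $ i * exp (- (Phi \<eta> w \<mu> C \<beta> $ i) / \<tau>) /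
      (\<Sum>l\<in>UNIV. \<pi> $ l * exp (- (Phi \<eta> w \<mu> C \<beta> $ l) / \<tau>)))"

definition dual_grad ::
  "real \<Rightarrow> real \<Rightarrow> ('k \<Rightarrow> real) \<Rightarrow> ('k \<Rightarrow> real^'m) \<Rightarrow> ('k \<Rightarrow> real^'m^'n) \<Rightarrow> real^'n
    \<Rightarrow> real^('k::finite \<times> 'm::finite) \<Rightarrow> real^('k \<times> 'm)" where
  "dual_grad \<eta> \<tau> w \<mu> C \<pi> \<beta> =
    (let v = bary \<eta> \<tau> w \<mu> C \<pi> \<beta>;
         P = (\<lambda>k. plan \<eta> (\<mu> k) (C k) (block \<beta> k))
     in \<chi> p. case p of (k, j) \<Rightarrow> (w k *\<^sub>R (transpose (P k) *v v - \<mu> k)) $ j)"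

definition dual_hess_block ::
  "real \<Rightarrow> real \<Rightarrow> ('k \<Rightarrow> real) \<Rightarrow> ('k \<Rightarrow> real^'m) \<Rightarrow> ('k \<Rightarrow> real^'m^'n) \<Rightarrow> real^'n
    \<Rightarrow> real^('k::finite \<times> 'm::finite) \<Rightarrow> 'k \<Rightarrow> 'k \<Rightarrow> real^'m^'m" where
  "dual_hess_block \<eta> \<tau> w \<mu> C \<pi> \<beta> k r =
    (let v = bary \<eta> \<tau> w \<mu> C \<pi> \<beta>;
         P = (\<lambda>k. plan \<eta> (\<mu> k) (C k) (block \<beta> k));
         \<gamma> = (\<lambda>k. transpose (P k) *v v)
     in if k = r
        then ((w k)\<^sup>2 / \<tau>) *\<^sub>R
               (transpose (P k) ** diag_matrix v ** P k - outer_prod (\<gamma> k) (\<gamma> k))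
             + (w k / \<eta>) *\<^sub>R
               (diag_matrix (\<gamma> k) - transpose (P k) ** diag_matrix v ** P k)
        else (w k * w r / \<tau>) *\<^sub>R
               (transpose (P k) ** diag_matrix v ** P r - outer_prod (\<gamma> k) (\<gamma> r)))"

definition dual_hess ::
  "real \<Rightarrow> real \<Rightarrow> ('k \<Rightarrow> real) \<Rightarrow> ('k \<Rightarrow> real^'m) \<Rightarrow> ('k \<Rightarrow> real^'m^'n) \<Rightarrow> real^'n
    \<Rightarrow> real^('k::finite \<times> 'm::finite) \<Rightarrow> real^('k \<times> 'm)^('k \<times> 'm)" where
  "dual_hess \<eta> \<tau> w \<mu> C \<pi> \<beta> =
    (\<chi> p q. case p of (k, i) \<Rightarrow> case q of (r, j) \<Rightarrow>
       dual_hess_block \<eta> \<tau> w \<mu> C \<pi> \<beta> k r $ i $ j)"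

definition matrix_ker :: "real^'a^'b \<Rightarrow> (real^'a) set" where
  "matrix_ker A = {d. A *v d = 0}"

definition blockwise_const :: "(real^('k::finite \<times> 'm::finite)) set" where
  "blockwise_const = {d. \<exists>c :: 'k \<Rightarrow> real. \<forall>k. block d k = c k *\<^sub>R 1}"

end

theory Submission
  imports Defs
begin

text \<open>
  The loss is built from two layers of the same function, the weighted log-sum-exp
  \<open>ln (\<Sum>\<^sub>i a\<^sub>i exp (f\<^sub>i))\<close>: the inner layer produces \<open>\<alpha>\<^sub>k\<close>, with softmax weights the rows of \<open>P\<^sub>k\<close>,
  and the outer one the logarithmic term of the loss, with softmax weights \<open>v\<close>. The derivative of
  log-sum-exp is the softmax average of the derivatives of the exponents, and the derivative of a
  softmax weight is that weight times the deviation of its exponent's derivative from this average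
  (\<open>ln_sum_exp_has_derivative\<close>, \<open>softmax_has_derivative\<close>). Applying this at both layers yields the
  gradient and the Hessian, the latter first in the form \<open>hess_apply\<close>.

  In this form the Hessian is a sum of variances. Write \<open>q = \<Sum>\<^sub>k w\<^sub>k P\<^sub>k d\<^sub>k\<close>. Then
  (\<open>hess_quadratic_form\<close>)
  \<open>d \<bullet> H d = Var\<^sub>v(q) / \<tau> + \<Sum>\<^sub>k \<Sum>\<^sub>i w\<^sub>k v\<^sub>i Var(d\<^sub>k under row i of P\<^sub>k) / \<eta>\<close>.
  This is nonnegative. If it vanishes, then each variance of \<open>d\<^sub>k\<close> under a row of \<open>P\<^sub>k\<close> does, because
  \<open>w\<close> and \<open>v\<close> are positive; as the support of every row of \<open>P\<^sub>k\<close> is the support of \<open>\<mu>\<^sub>k\<close>, the block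
  \<open>d\<^sub>k\<close> is constant on that support (\<open>kernel_const_on_support\<close>). Conversely, every deviation from a
  mean is zero for a blockwise constant vector, so such a vector lies in the kernel. For \<open>\<mu>\<close> with
  full support this determines the kernel.

  When \<open>\<mu>\<close> has zero entries the kernel is larger, but the gradient is still orthogonal to it: the
  gradient vanishes off the support of \<open>\<mu>\<^sub>k\<close>, and its \<open>k\<close>-th block sums to zero, since both
  \<open>P\<^sub>k\<^sup>T v\<close> and \<open>\<mu>\<^sub>k\<close> are probability vectors (\<open>grad_orthogonal_kernel\<close>). A symmetric matrix has the
  orthogonal complement of its kernel as range, so the Newton system is solvable.
\<close>

section \<open>Softmax weights and log-sum-exp\<close>

definition softmax :: "('a::finite \<Rightarrow> real) \<Rightarrow> ('a \<Rightarrow> real) \<Rightarrow> 'a \<Rightarrow> real" where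
  "softmax a f i = a i * exp (f i) / (\<Sum>l\<in>UNIV. a l * exp (f l))"

lemma weighted_exp_sum_pos:
  fixes a f :: "'a::finite \<Rightarrow> real"
  assumes "\<And>i. 0 \<le> a i" "(\<Sum>i\<in>UNIV. a i) = 1"
  shows "0 < (\<Sum>i\<in>UNIV. a i * exp (f i))"
proof -
  obtain i where "a i \<noteq> 0"
    using assms(2) by (metis sum.neutral zero_neq_one)
  then have "0 < a i * exp (f i)"
    using assms(1)[of i] by (simp add: less_le)
  then show ?thesis
    by (intro sum_pos2[of _ i]) (auto simp: assms(1))
qed

lemma softmax_nonneg:
  assumes "\<And>i. 0 \<le> a i"
  shows "0 \<le> softmax a f i"
  unfolding softmax_def by (intro divide_nonneg_nonneg sum_nonneg mult_nonneg_nonneg assms) auto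

lemma softmax_pos:
  assumes "\<And>i. 0 \<le> a i" "(\<Sum>i\<in>UNIV. a i) = 1" "0 < a i"
  shows "0 < softmax a f i"
  unfolding softmax_def using weighted_exp_sum_pos[OF assms(1,2)] assms(3) by simp

lemma softmax_sum:
  assumes "\<And>i. 0 \<le> a i" "(\<Sum>i\<in>UNIV. a i) = 1"
  shows "(\<Sum>i\<in>UNIV. softmax a f i) = 1"
  unfolding softmax_def using weighted_exp_sum_pos[OF assms, of f]
  by (simp flip: sum_divide_distrib)

lemma weighted_exp_sum_has_derivative:
  fixes a :: "'a::finite \<Rightarrow> real"
  assumes "\<And>i. (f i has_derivative f' i) (at x)"
  shows "((\<lambda>y. \<Sum>i\<in>UNIV. a i * exp (f i y)) has_derivative
          (\<lambda>d. \<Sum>i\<in>UNIV. a i * exp (f i x) * f' i d)) (at x)"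
proof -
  have "((\<lambda>y. exp (f i y)) has_derivative (\<lambda>d. exp (f i x) * f' i d)) (at x)" for i
    by (rule has_derivative_eq_rhs[OF has_derivative_exp[OF assms]]) (simp add: mult_ac)
  from has_derivative_sum[OF has_derivative_mult_right[OF this]] show ?thesis
    by (simp add: mult_ac)
qed

text \<open>
  The summands \<open>a\<^sub>i exp (f\<^sub>i)\<close> reappear as the coefficients of the derivative of the sum, and the
  logarithm divides them by the sum, which turns them into the softmax weights.
\<close>

lemma ln_sum_exp_has_derivative:
  fixes a :: "'a::finite \<Rightarrow> real"
  assumes a: "\<And>i. 0 \<le> a i" "(\<Sum>i\<in>UNIV. a i) = 1"
    and f: "\<And>i. (f i has_derivative f' i) (at x)"
  shows "((\<lambda>y. ln (\<Sum>i\<in>UNIV. a i * exp (f i y))) has_derivative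
          (\<lambda>d. \<Sum>i\<in>UNIV. softmax a (\<lambda>i. f i x) i * f' i d)) (at x)"
  by (rule has_derivative_eq_rhs[OF has_derivative_ln[OF _ weighted_exp_sum_has_derivative[OF f]]])
    (use weighted_exp_sum_pos[OF a] in \<open>auto simp: softmax_def sum_divide_distrib divide_inverse
      sum_distrib_left sum_distrib_right mult_ac\<close>)

text \<open>
  Writing a softmax weight as \<open>a\<^sub>j exp (f\<^sub>j - ln Z)\<close>, where \<open>Z\<close> is the normalising sum, reduces its
  derivative to that of log-sum-exp and avoids the quotient rule.
\<close>

lemma softmax_has_derivative:
  fixes a :: "'a::finite \<Rightarrow> real"
  assumes a: "\<And>i. 0 \<le> a i" "(\<Sum>i\<in>UNIV. a i) = 1"
    and f: "\<And>i. (f i has_derivative f' i) (at x)"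
  shows "((\<lambda>y. softmax a (\<lambda>i. f i y) j) has_derivative
          (\<lambda>d. softmax a (\<lambda>i. f i x) j *
            (f' j d - (\<Sum>i\<in>UNIV. softmax a (\<lambda>i. f i x) i * f' i d)))) (at x)"
proof -
  define Z where "Z y = (\<Sum>i\<in>UNIV. a i * exp (f i y))" for y
  have Z: "0 < Z y" for y
    unfolding Z_def by (rule weighted_exp_sum_pos[OF a])
  have eq: "softmax a (\<lambda>i. f i y) j = a j * exp (f j y - ln (Z y))" for y
    using Z[of y] by (simp add: softmax_def Z_def exp_diff)
  have "((\<lambda>y. f j y - ln (Z y)) has_derivative
      (\<lambda>d. f' j d - (\<Sum>i\<in>UNIV. softmax a (\<lambda>i. f i x) i * f' i d))) (at x)"
    unfolding Z_def by (intro has_derivative_diff f ln_sum_exp_has_derivative[OF a f])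
  from has_derivative_mult_right[OF has_derivative_exp[OF this], of "a j"] show ?thesis
    by (simp add: eq mult_ac)
qed

section \<open>Variances, symmetric matrices and blockwise constant vectors\<close>

text \<open>
  The deviation from the mean has mean zero, so subtracting the constant \<open>m\<close> from the first factor
  \<open>x i\<close> does not change the average.
\<close>

lemma variance_identity:
  fixes p x :: "'a::finite \<Rightarrow> real"
  assumes "(\<Sum>i\<in>UNIV. p i) = 1" and "m = (\<Sum>i\<in>UNIV. p i * x i)"
  shows "(\<Sum>i\<in>UNIV. p i * (x i * (x i - m))) = (\<Sum>i\<in>UNIV. p i * (x i - m)\<^sup>2)"
proof -
  have "(\<Sum>i\<in>UNIV. p i * (x i * (x i - m))) - (\<Sum>i\<in>UNIV. p i * (x i - m)\<^sup>2)
      = (\<Sum>i\<in>UNIV. m * (p i * x i) - m * m * p i)"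
    by (simp add: sum_subtractf[symmetric] power2_eq_square algebra_simps)
  also have "\<dots> = 0"
    by (simp add: sum_subtractf sum_distrib_left[symmetric] assms)
  finally show ?thesis by simp
qed

text \<open>
  The kernel of a linear map is the orthogonal complement of the range of its adjoint, which here
  is the map itself; in finite dimension the complement can be taken on the other side.
\<close>

lemma range_symmetric_matrix:
  fixes A :: "real^'a^'a"
  assumes "transpose A = A"
  shows "range ((*v) A) = (matrix_ker A)\<^sup>\<bottom>"
proof -
  have "adjoint ((*v) A) = (*v) A"
    by (simp add: adjoint_matrix assms)
  then have "matrix_ker A = (range ((*v) A))\<^sup>\<bottom>"
    using ker_orthogonal_comp_adjoint[of "(*v) A"]
    by (auto simp: matrix_ker_def matrix_vector_mul_linear)
  then show ?thesis
    by (simp add: orthogonal_comp_self linear_subspace_image)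
qed

lemma sum_transpose_diag:
  "(transpose P ** diag_matrix v ** Q) $ a $ b = (\<Sum>i\<in>UNIV. v $ i * P $ i $ a * Q $ i $ b)"
proof -
  have "(\<Sum>k\<in>UNIV. P $ k $ a * (if k = i then v $ k else 0)) = P $ i $ a * v $ i" for i
    by (simp add: if_distrib[of "\<lambda>t. _ * t"] sum.delta' cong: if_cong)
  then show ?thesis
    by (simp add: matrix_matrix_mult_def transpose_def diag_matrix_def mult_ac)
qed


lemma sum_UNIV_prod:
  fixes f :: "'a::finite \<times> 'b::finite \<Rightarrow> 'c::comm_monoid_add"
  shows "(\<Sum>p\<in>UNIV. f p) = (\<Sum>k\<in>UNIV. \<Sum>j\<in>UNIV. f (k, j))"
  by (simp add: sum.cartesian_product)

lemma blockwise_const_eq_image: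
  "(blockwise_const :: (real^('k::finite \<times> 'm::finite)) set) =
    range (\<lambda>c :: real^'k. \<chi> p. c $ fst p)"
proof (intro set_eqI iffI)
  fix d :: "real^('k \<times> 'm)"
  assume "d \<in> blockwise_const"
  then obtain c where "\<And>k j. d $ (k, j) = c k"
    by (auto simp: blockwise_const_def block_def vec_eq_iff)
  then have "d = (\<chi> p. (\<chi> k. c k) $ fst p)"
    by (simp add: vec_eq_iff)
  then show "d \<in> range (\<lambda>c :: real^'k. \<chi> p. c $ fst p)"
    by blast
qed (auto simp: blockwise_const_def block_def vec_eq_iff)

lemma
  shows subspace_blockwise_const: "subspace (blockwise_const :: (real^('k::finite \<times> 'm::finite)) set)"
    and dim_blockwise_const: "dim (blockwise_const :: (real^('k \<times> 'm)) set) = CARD('k)"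
proof -
  let ?e = "\<lambda>c :: real^'k. (\<chi> p. c $ fst p) :: real^('k \<times> 'm)"
  have lin: "linear ?e"
    by (rule linearI) (simp_all add: vec_eq_iff)
  have inj: "inj ?e"
    by (auto simp: inj_on_def vec_eq_iff)
  show "subspace (blockwise_const :: (real^('k \<times> 'm)) set)"
    unfolding blockwise_const_eq_image by (rule linear_subspace_image[OF lin subspace_UNIV])
  have "dim (range ?e) = dim (UNIV :: (real^'k) set)"
    using lin inj by (intro dim_image_eq) auto
  then show "dim (blockwise_const :: (real^('k \<times> 'm)) set) = CARD('k)"
    unfolding blockwise_const_eq_image by simp
qed

section \<open>The softmax structure of the dual problem\<close>

locale barycenter_dual =
  fixes \<eta> \<tau> :: real
    and w :: "'k::finite \<Rightarrow> real"
    and \<mu> :: "'k \<Rightarrow> real^'m::finite"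
    and C :: "'k \<Rightarrow> real^'m^'n::finite"
    and \<pi> :: "real^'n"
  assumes eta_pos: "0 < \<eta>" and tau_pos: "0 < \<tau>"
    and mu_simplex: "\<mu> k \<in> prob_simplex"
    and w_pos: "0 < w k"
    and pi_simplex: "\<pi> \<in> prob_simplex" and pi_pos: "0 < \<pi> $ i"
begin

abbreviation v :: "real^('k \<times> 'm) \<Rightarrow> 'n \<Rightarrow> real" where
  "v x i \<equiv> bary \<eta> \<tau> w \<mu> C \<pi> x $ i"

abbreviation P :: "real^('k \<times> 'm) \<Rightarrow> 'k \<Rightarrow> 'n \<Rightarrow> 'm \<Rightarrow> real" where
  "P x k i j \<equiv> plan \<eta> (\<mu> k) (C k) (block x k) $ i $ j"

abbreviation grad :: "real^('k \<times> 'm) \<Rightarrow> real^('k \<times> 'm)" where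
  "grad \<equiv> dual_grad \<eta> \<tau> w \<mu> C \<pi>"

abbreviation hess :: "real^('k \<times> 'm) \<Rightarrow> real^('k \<times> 'm)^('k \<times> 'm)" where
  "hess \<equiv> dual_hess \<eta> \<tau> w \<mu> C \<pi>"

text \<open>
  Read \<open>d\<close> as a random variable, with blocks \<open>d\<^sub>k\<close>. Given the row \<open>i\<close>, the index \<open>j\<close> in block \<open>k\<close>
  is drawn with probability \<open>P x k i j\<close>, and \<open>row_mean\<close> is the conditional expectation
  \<open>(P\<^sub>k d\<^sub>k)\<^sub>i\<close> of \<open>d\<^sub>k\<close>. The weights \<open>w\<close> combine these into the \<open>i\<close>-th entry of \<open>\<Sum>\<^sub>k w\<^sub>k P\<^sub>k d\<^sub>k\<close>, and
  averaging over a row \<open>i\<close> drawn from \<open>v\<close> gives \<open>total_mean\<close>.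
\<close>

definition row_mean :: "real^('k \<times> 'm) \<Rightarrow> real^('k \<times> 'm) \<Rightarrow> 'k \<Rightarrow> 'n \<Rightarrow> real" where
  "row_mean x d k i = (\<Sum>j\<in>UNIV. P x k i j * d $ (k, j))"

definition mixed_mean :: "real^('k \<times> 'm) \<Rightarrow> real^('k \<times> 'm) \<Rightarrow> 'n \<Rightarrow> real" where
  "mixed_mean x d i = (\<Sum>k\<in>UNIV. w k * row_mean x d k i)"

definition total_mean :: "real^('k \<times> 'm) \<Rightarrow> real^('k \<times> 'm) \<Rightarrow> real" where
  "total_mean x d = (\<Sum>i\<in>UNIV. v x i * mixed_mean x d i)"

lemma mu_nonneg: "0 \<le> \<mu> k $ j" and mu_sum: "(\<Sum>j\<in>UNIV. \<mu> k $ j) = 1"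
  using mu_simplex[of k] by (auto simp: prob_simplex_def)

lemma pi_nonneg: "0 \<le> \<pi> $ i" and pi_sum: "(\<Sum>i\<in>UNIV. \<pi> $ i) = 1"
  using pi_simplex by (auto simp: prob_simplex_def)

lemma P_softmax: "P x k i j = softmax (($) (\<mu> k)) (\<lambda>j. (x $ (k, j) - C k $ i $ j) / \<eta>) j"
  by (simp add: plan_def softmax_def block_def)

lemma v_softmax: "v x i = softmax (($) \<pi>) (\<lambda>i. - (Phi \<eta> w \<mu> C x $ i) / \<tau>) i"
  by (simp add: bary_def softmax_def)

lemma P_nonneg: "0 \<le> P x k i j"
  unfolding P_softmax by (intro softmax_nonneg mu_nonneg)

lemma P_sum: "(\<Sum>j\<in>UNIV. P x k i j) = 1"
  unfolding P_softmax by (intro softmax_sum mu_nonneg mu_sum)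

lemma P_pos: "0 < \<mu> k $ j \<Longrightarrow> 0 < P x k i j"
  unfolding P_softmax by (intro softmax_pos mu_nonneg mu_sum)

lemma P_zero: "\<mu> k $ j = 0 \<Longrightarrow> P x k i j = 0"
  by (simp add: P_softmax softmax_def)

lemma v_pos: "0 < v x i"
  unfolding v_softmax by (intro softmax_pos pi_nonneg pi_sum pi_pos)

lemma v_sum: "(\<Sum>i\<in>UNIV. v x i) = 1"
  unfolding v_softmax by (intro softmax_sum pi_nonneg pi_sum)

section \<open>Gradient and Hessian\<close>

lemma entry_has_derivative: "((\<lambda>y. y $ p) has_derivative (\<lambda>d. d $ p)) (at x)"
  by (rule bounded_linear.has_derivative[OF bounded_linear_vec_nth has_derivative_ident])

lemma exponent_has_derivative:
  "((\<lambda>y. (y $ (k, j) - c) / \<eta>) has_derivative (\<lambda>d. d $ (k, j) / \<eta>)) (at x)"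
  unfolding divide_inverse
  by (intro has_derivative_mult_left)
    (auto intro!: derivative_eq_intros entry_has_derivative)

text \<open>
  The prefactor \<open>- \<eta>\<close> of log-sum-exp cancels the \<open>\<eta>\<close> of the exponents, which leaves minus the
  softmax average of \<open>d\<^sub>k\<close>.
\<close>

lemma alpha_has_derivative:
  "((\<lambda>y. alpha \<eta> (\<mu> k) (C k) (block y k) $ i) has_derivative (\<lambda>d. - row_mean x d k i)) (at x)"
proof -
  have "((\<lambda>y. - \<eta> * ln (\<Sum>j\<in>UNIV. \<mu> k $ j * exp ((y $ (k, j) - C k $ i $ j) / \<eta>)))
      has_derivative (\<lambda>d. - \<eta> * (\<Sum>j\<in>UNIV. P x k i j * (d $ (k, j) / \<eta>)))) (at x)"
    unfolding P_softmax
    by (intro has_derivative_mult_right ln_sum_exp_has_derivative mu_nonneg mu_sum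
        exponent_has_derivative)
  then show ?thesis
    using eta_pos
    by (simp add: alpha_def block_def row_mean_def flip: sum_divide_distrib)
qed

lemma Phi_has_derivative:
  "((\<lambda>y. - (Phi \<eta> w \<mu> C y $ i) / \<tau>) has_derivative (\<lambda>d. mixed_mean x d i / \<tau>)) (at x)"
proof -
  have "((\<lambda>y. Phi \<eta> w \<mu> C y $ i) has_derivative (\<lambda>d. \<Sum>k\<in>UNIV. w k * - row_mean x d k i)) (at x)"
    unfolding Phi_def
    unfolding sum_component vector_scaleR_component real_scaleR_def
    by (intro has_derivative_sum has_derivative_mult_right alpha_has_derivative)
  from has_derivative_mult_right[OF this, of "- 1 / \<tau>"] show ?thesis
    by (simp add: mixed_mean_def sum_negf)
qed

lemma P_has_derivative:
  "((\<lambda>y. P y k i j) has_derivative (\<lambda>d. P x k i j * (d $ (k, j) - row_mean x d k i) / \<eta>)) (at x)"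
  unfolding P_softmax row_mean_def
  by (rule has_derivative_eq_rhs[OF softmax_has_derivative
        [OF mu_nonneg mu_sum exponent_has_derivative]])
    (simp add: right_diff_distrib diff_divide_distrib flip: sum_divide_distrib)

lemma v_has_derivative:
  "((\<lambda>y. v y i) has_derivative (\<lambda>d. v x i * (mixed_mean x d i - total_mean x d) / \<tau>)) (at x)"
  unfolding v_softmax total_mean_def
  by (rule has_derivative_eq_rhs[OF softmax_has_derivative
        [OF pi_nonneg pi_sum Phi_has_derivative]])
    (simp add: right_diff_distrib diff_divide_distrib flip: sum_divide_distrib)

lemma grad_entry:
  "grad x $ (k, j) = w k * ((\<Sum>i\<in>UNIV. v x i * P x k i j) - \<mu> k $ j)"
  by (simp add: dual_grad_def matrix_vector_mult_def transpose_def mult_ac)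

text \<open>
  Pulling the average over \<open>i\<close> inside shows \<open>total_mean x d\<close> as \<open>\<Sum>\<^sub>k w\<^sub>k (\<gamma>\<^sub>k \<bullet> d\<^sub>k)\<close> with \<open>\<gamma>\<^sub>k = P\<^sub>k\<^sup>T v\<close>. It
  is the form in which the mean enters the gradient and the rank-one parts of the Hessian.
\<close>

lemma total_mean_eq:
  "total_mean x d = (\<Sum>k\<in>UNIV. \<Sum>j\<in>UNIV. w k * (\<Sum>i\<in>UNIV. v x i * P x k i j) * d $ (k, j))"
proof -
  have "total_mean x d = (\<Sum>i\<in>UNIV. \<Sum>k\<in>UNIV. \<Sum>j\<in>UNIV. w k * (v x i * P x k i j) * d $ (k, j))"
    by (simp add: total_mean_def mixed_mean_def row_mean_def sum_distrib_left mult_ac)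
  also have "\<dots> = (\<Sum>k\<in>UNIV. \<Sum>i\<in>UNIV. \<Sum>j\<in>UNIV. w k * (v x i * P x k i j) * d $ (k, j))"
    by (rule sum.swap)
  also have "\<dots> = (\<Sum>k\<in>UNIV. \<Sum>j\<in>UNIV. \<Sum>i\<in>UNIV. w k * (v x i * P x k i j) * d $ (k, j))"
    by (intro sum.cong refl sum.swap)
  finally show ?thesis
    by (simp add: sum_distrib_left sum_distrib_right)
qed

lemma loss_gderiv: "GDERIV (dual_loss \<eta> \<tau> w \<mu> C \<pi>) x :> grad x"
proof -
  have linear_part: "((\<lambda>y. \<Sum>k\<in>UNIV. w k * (block y k \<bullet> \<mu> k)) has_derivative
      (\<lambda>d. \<Sum>k\<in>UNIV. w k * (block d k \<bullet> \<mu> k))) (at x)"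
    by (auto simp: inner_vec_def block_def
        intro!: has_derivative_sum has_derivative_mult_right has_derivative_mult_left entry_has_derivative)
  have log_part: "((\<lambda>y. \<tau> * ln (\<Sum>i\<in>UNIV. \<pi> $ i * exp (- (Phi \<eta> w \<mu> C y $ i) / \<tau>))) has_derivative
      total_mean x) (at x)"
    by (rule has_derivative_eq_rhs[OF has_derivative_mult_right[OF ln_sum_exp_has_derivative
            [OF pi_nonneg pi_sum Phi_has_derivative]]])
      (use tau_pos in \<open>simp add: fun_eq_iff total_mean_def v_softmax flip: sum_divide_distrib\<close>)
  have "d \<bullet> grad x = - (\<Sum>k\<in>UNIV. w k * (block d k \<bullet> \<mu> k)) + total_mean x d" for d
    by (simp add: inner_vec_def sum_UNIV_prod grad_entry block_def total_mean_eq
        right_diff_distrib sum_subtractf sum_distrib_left sum_distrib_right mult_ac)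
  then show ?thesis
    unfolding gderiv_def dual_loss_def[abs_def]
    using has_derivative_add[OF has_derivative_minus[OF linear_part] log_part] by simp
qed

text \<open>
  The diagonal and off-diagonal blocks share the coupling term of weight \<open>1 / \<tau>\<close>; a diagonal block
  only adds the term of weight \<open>1 / \<eta>\<close>.
\<close>

lemma hess_entry:
  "hess x $ (k, a) $ (r, b) =
    w k * w r / \<tau> * ((\<Sum>i\<in>UNIV. v x i * P x k i a * P x r i b)
      - (\<Sum>i\<in>UNIV. v x i * P x k i a) * (\<Sum>i\<in>UNIV. v x i * P x r i b))
    + (if k = r then w k / \<eta> * ((if a = b then \<Sum>i\<in>UNIV. v x i * P x k i a else 0)
      - (\<Sum>i\<in>UNIV. v x i * P x k i a * P x k i b)) else 0)"
proof -
  have \<gamma>: "(bary \<eta> \<tau> w \<mu> C \<pi> x v* plan \<eta> (\<mu> k) (C k) (block x k)) $ a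
      = (\<Sum>i\<in>UNIV. v x i * P x k i a)" for k a
    by (simp add: vector_matrix_mult_def mult.commute)
  have \<Gamma>: "diag_matrix u $ a $ b = (if a = b then u $ a else 0)" for u :: "real^'m" and a b
    by (simp add: diag_matrix_def)
  show ?thesis
    by (simp add: dual_hess_def dual_hess_block_def Let_def sum_transpose_diag outer_prod_def \<gamma>
        \<Gamma> power2_eq_square)
qed

lemma hess_symmetric: "transpose (hess x) = hess x"
proof -
  have "hess x $ (r, b) $ (k, a) = hess x $ (k, a) $ (r, b)" for k r a b
  proof -
    have "(\<Sum>i\<in>UNIV. v x i * P x r i b * P x k i a) = (\<Sum>i\<in>UNIV. v x i * P x k i a * P x r i b)"
      by (intro sum.cong refl) simp
    then show ?thesis
      unfolding hess_entry by (cases "k = r"; cases "a = b") (simp_all add: mult.commute)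
  qed
  then show ?thesis
    by (simp add: vec_eq_iff transpose_def split_paired_all)
qed

text \<open>
  Summing the entries against \<open>d\<close> produces only means of \<open>d\<close>: \<open>P\<^sub>k\<^sup>T diag(v) P\<^sub>r\<close> contributes row
  means and \<open>\<gamma>\<^sub>k \<gamma>\<^sub>r\<^sup>T\<close> the total mean. Grouped by rows \<open>i\<close>, the result is the product rule for
  \<open>v\<^sub>i P\<^sub>k\<^sub>i\<^sub>a\<close>: the derivative of \<open>v\<^sub>i\<close> carries the factor \<open>1 / \<tau>\<close>, that of \<open>P\<^sub>k\<^sub>i\<^sub>a\<close> the factor \<open>1 / \<eta>\<close>.
\<close>

lemma hess_apply:
  "(hess x *v d) $ (k, a) =
    w k * (\<Sum>i\<in>UNIV. v x i * P x k i a *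
      ((mixed_mean x d i - total_mean x d) / \<tau> + (d $ (k, a) - row_mean x d k i) / \<eta>))"
proof -
  let ?\<gamma> = "\<lambda>k a. \<Sum>i\<in>UNIV. v x i * P x k i a"
  have mixed: "(\<Sum>r\<in>UNIV. \<Sum>b\<in>UNIV. w r * (\<Sum>i\<in>UNIV. v x i * P x k i a * P x r i b) * d $ (r, b))
      = (\<Sum>i\<in>UNIV. v x i * P x k i a * mixed_mean x d i)"
  proof -
    have "(\<Sum>i\<in>UNIV. v x i * P x k i a * mixed_mean x d i)
        = (\<Sum>i\<in>UNIV. \<Sum>r\<in>UNIV. \<Sum>b\<in>UNIV. w r * (v x i * P x k i a * P x r i b) * d $ (r, b))"
      by (simp add: mixed_mean_def row_mean_def sum_distrib_left mult_ac)
    also have "\<dots> = (\<Sum>r\<in>UNIV. \<Sum>i\<in>UNIV. \<Sum>b\<in>UNIV. w r * (v x i * P x k i a * P x r i b) * d $ (r, b))"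
      by (rule sum.swap)
    also have "\<dots> = (\<Sum>r\<in>UNIV. \<Sum>b\<in>UNIV. \<Sum>i\<in>UNIV. w r * (v x i * P x k i a * P x r i b) * d $ (r, b))"
      by (intro sum.cong refl sum.swap)
    finally show ?thesis
      by (simp add: sum_distrib_left sum_distrib_right)
  qed
  have row: "(\<Sum>b\<in>UNIV. (\<Sum>i\<in>UNIV. v x i * P x k i a * P x k i b) * d $ (k, b))
      = (\<Sum>i\<in>UNIV. v x i * P x k i a * row_mean x d k i)"
  proof -
    have "(\<Sum>i\<in>UNIV. v x i * P x k i a * row_mean x d k i)
        = (\<Sum>i\<in>UNIV. \<Sum>b\<in>UNIV. v x i * P x k i a * P x k i b * d $ (k, b))"
      by (simp add: row_mean_def sum_distrib_left mult_ac)
    also have "\<dots> = (\<Sum>b\<in>UNIV. \<Sum>i\<in>UNIV. v x i * P x k i a * P x k i b * d $ (k, b))"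
      by (rule sum.swap)
    finally show ?thesis
      by (simp add: sum_distrib_right)
  qed
  define coup where "coup r b = w k / \<tau> *
      (w r * (\<Sum>i\<in>UNIV. v x i * P x k i a * P x r i b) * d $ (r, b)
      - ?\<gamma> k a * (w r * ?\<gamma> r b * d $ (r, b)))" for r b
  define diag where "diag b = w k / \<eta> * ((if a = b then ?\<gamma> k a * d $ (k, b) else 0)
      - (\<Sum>i\<in>UNIV. v x i * P x k i a * P x k i b) * d $ (k, b))" for b
  have "hess x $ (k, a) $ (r, b) * d $ (r, b)
      = coup r b + (if k = r then diag b else 0)" for r b
    by (simp add: hess_entry coup_def diag_def algebra_simps)
  then have "(hess x *v d) $ (k, a)
      = (\<Sum>r\<in>UNIV. \<Sum>b\<in>UNIV. coup r b + (if k = r then diag b else 0))"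
    by (simp add: matrix_vector_mult_def sum_UNIV_prod)
  also have "\<dots> = (\<Sum>r\<in>UNIV. \<Sum>b\<in>UNIV. coup r b) + (\<Sum>r\<in>UNIV. if k = r then \<Sum>b\<in>UNIV. diag b else 0)"
  proof -
    have "(\<Sum>b\<in>UNIV. if k = r then diag b else 0) = (if k = r then \<Sum>b\<in>UNIV. diag b else 0)" for r
      by simp
    then show ?thesis
      by (simp only: sum.distrib)
  qed
  also have "(\<Sum>r\<in>UNIV. if k = r then \<Sum>b\<in>UNIV. diag b else 0) = (\<Sum>b\<in>UNIV. diag b)"
    by simp
  also have "(\<Sum>r\<in>UNIV. \<Sum>b\<in>UNIV. coup r b)
      = w k / \<tau> * ((\<Sum>i\<in>UNIV. v x i * P x k i a * mixed_mean x d i) - ?\<gamma> k a * total_mean x d)"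
    unfolding coup_def by (simp only: sum_distrib_left[symmetric] sum_subtractf mixed total_mean_eq)
  also have "(\<Sum>b\<in>UNIV. diag b)
      = w k / \<eta> * (?\<gamma> k a * d $ (k, a) - (\<Sum>i\<in>UNIV. v x i * P x k i a * row_mean x d k i))"
    unfolding diag_def by (simp only: sum_distrib_left[symmetric] sum_subtractf row) simp
  also have "w k / \<tau> * ((\<Sum>i\<in>UNIV. v x i * P x k i a * mixed_mean x d i) - ?\<gamma> k a * total_mean x d)
      + w k / \<eta> * (?\<gamma> k a * d $ (k, a) - (\<Sum>i\<in>UNIV. v x i * P x k i a * row_mean x d k i))
      = w k * (\<Sum>i\<in>UNIV. v x i * P x k i a *
      ((mixed_mean x d i - total_mean x d) / \<tau> + (d $ (k, a) - row_mean x d k i) / \<eta>))"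
  proof -
    have "w k * (v x i * P x k i a *
          ((mixed_mean x d i - total_mean x d) / \<tau> + (d $ (k, a) - row_mean x d k i) / \<eta>))
        = w k / \<tau> * (v x i * P x k i a * mixed_mean x d i - v x i * P x k i a * total_mean x d)
          + w k / \<eta> * (v x i * P x k i a * d $ (k, a) - v x i * P x k i a * row_mean x d k i)" for i
      by (simp add: distrib_left right_diff_distrib diff_divide_distrib mult_ac)
    then show ?thesis
      by (simp only: sum_distrib_left[of "w k"] sum.distrib)
        (simp only: sum_distrib_left[symmetric] sum_subtractf sum_distrib_right)
  qed
  finally show ?thesis .
qed

lemma grad_has_derivative:
  "(grad has_derivative (\<lambda>d. hess x *v d)) (at x)"
proof -
  have entry: "((\<lambda>y. grad y $ (k, a)) has_derivative
      (\<lambda>d. (hess x *v d) $ (k, a))) (at x)" for k a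
    unfolding grad_entry hess_apply
    by (rule has_derivative_eq_rhs[OF has_derivative_mult_right[OF has_derivative_diff
            [OF has_derivative_sum[OF has_derivative_mult[OF v_has_derivative P_has_derivative]]
              has_derivative_const]]])
      (simp add: fun_eq_iff algebra_simps)
  show ?thesis
    by (rule has_derivative_componentwise_within[THEN iffD2])
      (auto simp: Basis_vec_def inner_axis entry)
qed

section \<open>Positive semidefiniteness, kernel and consistency\<close>

text \<open>
  In \<open>hess_apply\<close> the two deviations are multiplied by \<open>d (k, a)\<close> and averaged. The second one stays
  inside row \<open>i\<close> and gives the variance of \<open>d\<^sub>k\<close> there. The first one depends only on \<open>i\<close>, so
  summing over \<open>a\<close> and \<open>k\<close> turns its factor \<open>d\<close> into \<open>mixed_mean x d i\<close>, and the average over \<open>i\<close> gives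
  the variance of \<open>mixed_mean\<close>.
\<close>

lemma hess_quadratic_form:
  "d \<bullet> (hess x *v d) =
    (\<Sum>i\<in>UNIV. v x i * (mixed_mean x d i - total_mean x d)\<^sup>2) / \<tau> +
    (\<Sum>k\<in>UNIV. \<Sum>i\<in>UNIV. w k * v x i *
      (\<Sum>j\<in>UNIV. P x k i j * (d $ (k, j) - row_mean x d k i)\<^sup>2)) / \<eta>"
proof -
  have "d \<bullet> (hess x *v d) = (\<Sum>k\<in>UNIV. \<Sum>i\<in>UNIV. \<Sum>j\<in>UNIV. w k * v x i *
      (P x k i j * (d $ (k, j) *
        ((mixed_mean x d i - total_mean x d) / \<tau> + (d $ (k, j) - row_mean x d k i) / \<eta>))))"
  proof -
    have "d \<bullet> (hess x *v d) = (\<Sum>k\<in>UNIV. \<Sum>j\<in>UNIV. \<Sum>i\<in>UNIV. w k * v x i * (P x k i j * (d $ (k, j) *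
        ((mixed_mean x d i - total_mean x d) / \<tau> + (d $ (k, j) - row_mean x d k i) / \<eta>))))"
      by (simp add: inner_vec_def sum_UNIV_prod hess_apply sum_distrib_left mult_ac)
    also have "\<dots> = (\<Sum>k\<in>UNIV. \<Sum>i\<in>UNIV. \<Sum>j\<in>UNIV. w k * v x i * (P x k i j * (d $ (k, j) *
        ((mixed_mean x d i - total_mean x d) / \<tau> + (d $ (k, j) - row_mean x d k i) / \<eta>))))"
      by (intro sum.cong refl sum.swap)
    finally show ?thesis .
  qed
  also have "\<dots> = (\<Sum>k\<in>UNIV. \<Sum>i\<in>UNIV. w k * v x i *
      (row_mean x d k i * ((mixed_mean x d i - total_mean x d) / \<tau>)
       + (\<Sum>j\<in>UNIV. P x k i j * (d $ (k, j) - row_mean x d k i)\<^sup>2) / \<eta>))"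
  proof (intro sum.cong refl)
    fix k i
    let ?c = "(mixed_mean x d i - total_mean x d) / \<tau>" and ?m = "row_mean x d k i"
    have "P x k i j * (d $ (k, j) * (?c + (d $ (k, j) - ?m) / \<eta>))
        = P x k i j * d $ (k, j) * ?c + P x k i j * (d $ (k, j) * (d $ (k, j) - ?m)) / \<eta>" for j
      by (simp add: distrib_left)
    then have "(\<Sum>j\<in>UNIV. P x k i j * (d $ (k, j) * (?c + (d $ (k, j) - ?m) / \<eta>)))
        = (\<Sum>j\<in>UNIV. P x k i j * d $ (k, j)) * ?c
          + (\<Sum>j\<in>UNIV. P x k i j * (d $ (k, j) * (d $ (k, j) - ?m))) / \<eta>"
      by (simp only: sum.distrib sum_distrib_right sum_divide_distrib)
    also have "\<dots> = ?m * ?c + (\<Sum>j\<in>UNIV. P x k i j * (d $ (k, j) - ?m)\<^sup>2) / \<eta>"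
      by (simp add: variance_identity[OF P_sum row_mean_def] row_mean_def[symmetric])
    finally show "(\<Sum>j\<in>UNIV. w k * v x i * (P x k i j * (d $ (k, j) * (?c + (d $ (k, j) - ?m) / \<eta>))))
       = w k * v x i * (?m * ?c + (\<Sum>j\<in>UNIV. P x k i j * (d $ (k, j) - ?m)\<^sup>2) / \<eta>)"
      by (simp add: sum_distrib_left[symmetric])
  qed
  also have "\<dots> = (\<Sum>i\<in>UNIV. v x i * (mixed_mean x d i * (mixed_mean x d i - total_mean x d))) / \<tau> +
    (\<Sum>k\<in>UNIV. \<Sum>i\<in>UNIV. w k * v x i *
      (\<Sum>j\<in>UNIV. P x k i j * (d $ (k, j) - row_mean x d k i)\<^sup>2)) / \<eta>"
  proof -
    have "(\<Sum>k\<in>UNIV. \<Sum>i\<in>UNIV.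
          w k * v x i * (row_mean x d k i * ((mixed_mean x d i - total_mean x d) / \<tau>)))
        = (\<Sum>i\<in>UNIV. \<Sum>k\<in>UNIV.
          w k * v x i * (row_mean x d k i * ((mixed_mean x d i - total_mean x d) / \<tau>)))"
      by (rule sum.swap)
    also have "\<dots> = (\<Sum>i\<in>UNIV. v x i * ((\<Sum>k\<in>UNIV. w k * row_mean x d k i) *
        (mixed_mean x d i - total_mean x d))) / \<tau>"
      by (simp add: sum_distrib_left sum_distrib_right sum_divide_distrib mult_ac)
    finally have "(\<Sum>k\<in>UNIV. \<Sum>i\<in>UNIV.
          w k * v x i * (row_mean x d k i * ((mixed_mean x d i - total_mean x d) / \<tau>)))
        = (\<Sum>i\<in>UNIV. v x i * (mixed_mean x d i * (mixed_mean x d i - total_mean x d))) / \<tau>"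
      by (simp only: mixed_mean_def[symmetric])
    then show ?thesis
      by (simp only: distrib_left sum.distrib times_divide_eq_right sum_divide_distrib[symmetric])
  qed
  finally show ?thesis
    by (simp add: variance_identity[OF v_sum total_mean_def])
qed

lemma row_variance_nonneg:
  "0 \<le> w k * v x i * (\<Sum>j\<in>UNIV. P x k i j * (d $ (k, j) - row_mean x d k i)\<^sup>2)"
  by (intro mult_nonneg_nonneg sum_nonneg P_nonneg less_imp_le[OF w_pos] less_imp_le[OF v_pos]) auto

lemma row_variances_nonneg:
  "0 \<le> (\<Sum>k\<in>UNIV. \<Sum>i\<in>UNIV. w k * v x i *
      (\<Sum>j\<in>UNIV. P x k i j * (d $ (k, j) - row_mean x d k i)\<^sup>2))"
  by (intro sum_nonneg row_variance_nonneg)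

lemma mixed_variance_nonneg:
  "0 \<le> (\<Sum>i\<in>UNIV. v x i * (mixed_mean x d i - total_mean x d)\<^sup>2)"
  by (intro sum_nonneg mult_nonneg_nonneg less_imp_le[OF v_pos]) auto

lemma hess_nonneg: "0 \<le> d \<bullet> (hess x *v d)"
  unfolding hess_quadratic_form
  using mixed_variance_nonneg row_variances_nonneg eta_pos tau_pos by simp

text \<open>
  All summands of the quadratic form are nonnegative, so on the kernel each row variance of \<open>d\<^sub>k\<close>
  vanishes, and \<open>d\<^sub>k\<close> equals its row mean wherever the row charges, that is on the support of \<open>\<mu>\<^sub>k\<close>.
\<close>

lemma kernel_const_on_support:
  assumes "d \<in> matrix_ker (hess x)"
  obtains c where "\<And>k j. 0 < \<mu> k $ j \<Longrightarrow> d $ (k, j) = c k"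
proof
  fix k j
  assume mu: "0 < \<mu> k $ j"
  \<comment> \<open>All rows of \<open>P\<^sub>k\<close> have the same support, so the mean along any one row can serve as \<open>c k\<close>.\<close>
  let ?i = "undefined :: 'n"
  have "d \<bullet> (hess x *v d) = 0"
    using assms by (simp add: matrix_ker_def)
  then have "(\<Sum>k\<in>UNIV. \<Sum>i\<in>UNIV. w k * v x i *
      (\<Sum>j\<in>UNIV. P x k i j * (d $ (k, j) - row_mean x d k i)\<^sup>2)) = 0"
    unfolding hess_quadratic_form
    using divide_nonneg_pos[OF mixed_variance_nonneg tau_pos, of x d]
      divide_nonneg_pos[OF row_variances_nonneg eta_pos, of x d] eta_pos
    by (simp add: add_nonneg_eq_0_iff)
  then have "\<forall>k i. w k * v x i * (\<Sum>j\<in>UNIV. P x k i j * (d $ (k, j) - row_mean x d k i)\<^sup>2) = 0"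
    by (simp add: sum_nonneg_eq_0_iff sum_nonneg row_variance_nonneg del: mult_eq_0_iff)
  then have "w k * v x ?i * (\<Sum>j\<in>UNIV. P x k ?i j * (d $ (k, j) - row_mean x d k ?i)\<^sup>2) = 0"
    by blast
  then have "(\<Sum>j\<in>UNIV. P x k ?i j * (d $ (k, j) - row_mean x d k ?i)\<^sup>2) = 0"
    using w_pos[of k] v_pos[of x ?i] by simp
  then have "P x k ?i j * (d $ (k, j) - row_mean x d k ?i)\<^sup>2 = 0"
    by (simp add: sum_nonneg_eq_0_iff P_nonneg del: mult_eq_0_iff)
  then show "d $ (k, j) = row_mean x d k ?i"
    using P_pos[OF mu, of x ?i] by simp
qed

text \<open>All means of a blockwise constant vector are constants, so each deviation is zero.\<close>

lemma blockwise_const_in_kernel: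
  "blockwise_const \<subseteq> matrix_ker (hess x)"
proof
  fix d :: "real^('k \<times> 'm)"
  assume "d \<in> blockwise_const"
  then obtain c where c: "\<And>k j. d $ (k, j) = c k"
    by (auto simp: blockwise_const_def block_def vec_eq_iff)
  have row: "row_mean x d k i = c k" for k i
    by (simp add: row_mean_def c P_sum flip: sum_distrib_right)
  have mixed: "mixed_mean x d i = (\<Sum>k\<in>UNIV. w k * c k)" for i
    by (simp add: mixed_mean_def row)
  have total: "total_mean x d = (\<Sum>k\<in>UNIV. w k * c k)"
    by (simp add: total_mean_def mixed v_sum flip: sum_distrib_right)
  show "d \<in> matrix_ker (hess x)"
    by (auto simp: matrix_ker_def vec_eq_iff hess_apply c row mixed total)
qed

lemma kernel_eq_blockwise_const:
  assumes "\<And>k j. 0 < \<mu> k $ j"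
  shows "matrix_ker (hess x) = blockwise_const"
proof (intro equalityI subsetI)
  fix d assume "d \<in> matrix_ker (hess x)"
  then obtain c where "\<And>k j. d $ (k, j) = c k"
    using kernel_const_on_support assms by metis
  then show "d \<in> blockwise_const"
    by (auto simp: blockwise_const_def block_def vec_eq_iff)
qed (use blockwise_const_in_kernel in blast)

text \<open>
  On the support of \<open>\<mu>\<^sub>k\<close> a kernel vector equals a constant \<open>c k\<close>; off the support the gradient is
  zero. So the inner product is \<open>\<Sum>\<^sub>k c\<^sub>k s\<^sub>k\<close> with \<open>s\<^sub>k\<close> the sum of the \<open>k\<close>-th gradient block, and
  \<open>s\<^sub>k = w\<^sub>k (1 - 1)\<close> because \<open>P\<^sub>k\<^sup>T v\<close> and \<open>\<mu>\<^sub>k\<close> both have total mass one.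
\<close>

lemma grad_orthogonal_kernel:
  "grad x \<in> (matrix_ker (hess x))\<^sup>\<bottom>"
  unfolding orthogonal_comp_def orthogonal_def
proof (intro CollectI ballI)
  fix d assume "d \<in> matrix_ker (hess x)"
  then obtain c where c: "\<And>k j. 0 < \<mu> k $ j \<Longrightarrow> d $ (k, j) = c k"
    using kernel_const_on_support by blast
  let ?g = "grad x"
  have "d $ (k, j) * ?g $ (k, j) = c k * ?g $ (k, j)" for k j
  proof (cases "\<mu> k $ j = 0")
    case True
    then show ?thesis by (simp add: grad_entry P_zero)
  next
    case False
    then show ?thesis using c[of k j] mu_nonneg[of k j] by simp
  qed
  then have "d \<bullet> ?g = (\<Sum>k\<in>UNIV. c k * (\<Sum>j\<in>UNIV. ?g $ (k, j)))"
    by (simp only: inner_vec_def inner_real_def sum_UNIV_prod sum_distrib_left)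
  moreover have "(\<Sum>j\<in>UNIV. ?g $ (k, j)) = 0" for k
  proof -
    have "(\<Sum>j\<in>UNIV. \<Sum>i\<in>UNIV. v x i * P x k i j) = (\<Sum>i\<in>UNIV. v x i * (\<Sum>j\<in>UNIV. P x k i j))"
      by (subst sum.swap) (simp add: sum_distrib_left)
    then show ?thesis
      by (simp add: grad_entry sum_subtractf mu_sum P_sum v_sum flip: sum_distrib_left)
  qed
  ultimately show "d \<bullet> ?g = 0" by simp
qed

lemma newton_consistent: "\<exists>d. hess x *v d = - grad x"
proof -
  have "- grad x \<in> (matrix_ker (hess x))\<^sup>\<bottom>"
    by (intro subspace_neg subspace_orthogonal_comp grad_orthogonal_kernel)
  then show ?thesis
    unfolding range_symmetric_matrix[OF hess_symmetric, symmetric] by (auto simp: image_iff eq_commute)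
qed

end

theorem proposition3p1:
  fixes \<eta> \<tau> :: real
    and w :: "'k::finite \<Rightarrow> real"
    and \<mu> :: "'k \<Rightarrow> real^'m::finite"
    and C :: "'k \<Rightarrow> real^'m^'n::finite"
    and \<pi> :: "real^'n"
    and \<beta> :: "real^('k \<times> 'm)"
  assumes "\<eta> > 0" and "\<tau> > 0"
    and "\<And>k. \<mu> k \<in> prob_simplex"
    and "\<And>k i j. 0 \<le> C k $ i $ j"
    and "\<And>k. w k > 0" and "(\<Sum>k\<in>UNIV. w k) = 1"
    and "\<pi> \<in> prob_simplex" and "\<And>i. \<pi> $ i > 0"
  shows "let L = dual_loss \<eta> \<tau> w \<mu> C \<pi>;
             g = dual_grad \<eta> \<tau> w \<mu> C \<pi>;
             H = dual_hess \<eta> \<tau> w \<mu> C \<pi> \<beta>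
         in
           \<comment> \<open>\<open>g\<close> is the gradient field of \<open>L\<close> and \<open>H\<close> is the Hessian of \<open>L\<close> at \<open>\<beta>\<close>\<close>
           (\<forall>x. GDERIV L x :> g x) \<and> (g has_derivative (\<lambda>d. H *v d)) (at \<beta>) \<and>
           transpose H = H \<and> (\<forall>d. 0 \<le> d \<bullet> (H *v d)) \<and>
           \<comment> \<open>\<open>matrix_ker H = blockwise_const\<close> fails when some \<open>\<mu> k\<close> has a zero entry\<close>
           subspace (blockwise_const :: (real^('k \<times> 'm)) set) \<and>
           dim (blockwise_const :: (real^('k \<times> 'm)) set) = CARD('k) \<and>
           blockwise_const \<subseteq> matrix_ker H \<and>
           ((\<forall>k j. 0 < \<mu> k $ j) \<longrightarrow> matrix_ker H = blockwise_const) \<and>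
           g \<beta> \<in> (matrix_ker H)\<^sup>\<bottom> \<and>
           (\<exists>d. H *v d = - g \<beta>)"
proof -
  interpret barycenter_dual \<eta> \<tau> w \<mu> C \<pi>
    by unfold_locales (use assms in auto)
  show ?thesis
    unfolding Let_def
    by (intro conjI allI impI loss_gderiv grad_has_derivative hess_symmetric hess_nonneg
        subspace_blockwise_const dim_blockwise_const blockwise_const_in_kernel
        kernel_eq_blockwise_const grad_orthogonal_kernel newton_consistent) blast
qed

end
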